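(* Let $A\in\mathbb{R}^{n\times n}$ be nonsingular, $u,v,b\in\mathbb{R}^n$, and suppose that the linear systems $Ay=b$ and $Az=u$ are solved normwise backward stably with stability constant $c_s$. Let $\widehat x$ be the solution of $(A+uv^T)x=b$ computed by the Sherman--Morrison algorithm (SM) in floating point arithmetic with unit roundoff $\epsilon_M$, and let $\widehat y$ be the computed solution of $Ay=b$ in that algorithm. Then the relative backward error $$\omega(\widehat x)=\frac{\|b-(A+uv^T)\widehat x\|}{\|A+uv^T\|\,\|\widehat x\|+\|b\|}$$ satisfies $$\omega(\widehat x)\le\epsilon_M(n+2+c_s)\frac{\big(\|A\|+\|u\|\|v\|\big)\|\widehat x\|+\|b\|}{\|A+uv^T\|\,\|\widehat x\|+\|b\|}+\epsilon_M(2n+3+2c_s)\frac{\big(\|A\|+\|u\|\|v\|\big)\|\widehat y\|}{\|A+uv^T\|\,\|\widehat x\|+\|b\|}+\mathcal O(\epsilon_M^2).$$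
   Context: Norms: $\|\cdot\|$ is the Euclidean vector norm and the induced matrix 2-norm. Algorithm SM (for $(A+uv^T)x=b$): (1) solve $Ay=b$ for $y$; (2) solve $Az=u$ for $z$; (3) compute $\alpha=v^Ty$, $\beta=1+v^Tz$, $\theta=\alpha/\beta$; (4) output $x=y-z\theta$. Hats denote the quantities actually computed in floating point arithmetic. The matrix $A+uv^T$ is nonsingular (equivalently, the exact $\beta$ is nonzero), the algorithm runs to completion, so the computed $\widehat\beta$ is nonzero, and the denominator in $\omega(\widehat x)$ is nonzero. Floating point model: $\epsilon_M$ is the unit roundoff, $n\epsilon_M<1$, $\gamma_n=n\epsilon_M/(1-n\epsilon_M)$. Every scalar operation satisfies $\mathrm{fl}(a\circ b)=(a\circ b)(1+\delta)$, $|\delta|\le\epsilon_M$, $\circ\in\{+,-,\times,/\}$ (vector operations being performed entrywise). A computed inner product satisfies $\mathrm{fl}(v^Tw)=v^T(I+D)w$ with $D$ diagonal and $|D|\le\gamma_n I$ entrywise. Normwise backward stable solve with constant $c_s$ (a fixed constant independent of $\epsilon_M$): for a right-hand side $g$, the computed solution $\widehat s$ of $As=g$ satisfies $(A+\delta A)\widehat s=g+\delta g$ for some $\delta A,\delta g$ (which may differ from solve to solve) with $\|\delta A\|\le c_s\epsilon_M\|A\|$ and $\|\delta g\|\le c_s\epsilon_M\|g\|$. $\mathcal O(\epsilon_M^2)$ denotes a quantity bounded in absolute value by $C\epsilon_M^2$ for all sufficiently small $\epsilon_M>0$, where $C$ and the smallness threshold may depend on $n,c_s,A,u,v,b$ but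 not on $\epsilon_M$ or on the particular rounding errors committed. *)

theory Defs
  imports "HOL-Analysis.Analysis"
begin

definition outer :: "real^'n \<Rightarrow> real^'n \<Rightarrow> real^'n^'n" where
  "outer u v = (\<chi> i j. u $ i * v $ j)"

text \<open>The induced 2-norm; the type-class \<open>norm\<close> of a matrix is the Frobenius norm.\<close>

definition mnorm :: "real^'n^'n \<Rightarrow> real" where
  "mnorm A = onorm ((*v) A)"

definition gam :: "nat \<Rightarrow> real \<Rightarrow> real" where
  "gam n \<epsilon> = real n * \<epsilon> / (1 - real n * \<epsilon>)"

text \<open>
  Floating point operations are modelled as relations between exact data and computed values:
  every value compatible with the error bounds with unit roundoff \<open>\<epsilon>\<close> is admitted.
  In \<open>rounded \<epsilon> t s\<close>, \<open>t\<close> is the exact result \<open>a \<circ> b\<close> of one scalar operation and \<open>s\<close> is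
  the computed \<open>fl(a \<circ> b)\<close>.
\<close>

definition rounded :: "real \<Rightarrow> real \<Rightarrow> real \<Rightarrow> bool" where
  "rounded \<epsilon> t s \<longleftrightarrow> (\<exists>\<delta>. \<bar>\<delta>\<bar> \<le> \<epsilon> \<and> s = t * (1 + \<delta>))"

definition rounded_vec :: "real \<Rightarrow> real^'n \<Rightarrow> real^'n \<Rightarrow> bool" where
  "rounded_vec \<epsilon> t s \<longleftrightarrow> (\<forall>i. rounded \<epsilon> (t $ i) (s $ i))"

text \<open>The entrywise bound \<open>\<bar>D\<bar> \<le> \<gamma>\<^sub>n I\<close> forces \<open>D\<close> to be diagonal.\<close>

definition computed_inner :: "real \<Rightarrow> real^'n \<Rightarrow> real^'n \<Rightarrow> real \<Rightarrow> bool" where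
  "computed_inner \<epsilon> v w s \<longleftrightarrow>
     (\<exists>D :: real^'n^'n. (\<forall>i j. \<bar>D $ i $ j\<bar> \<le> gam CARD('n) \<epsilon> * mat 1 $ i $ j) \<and>
        s = v \<bullet> ((mat 1 + D) *v w))"

definition backward_stable_solution ::
    "real \<Rightarrow> real \<Rightarrow> real^'n^'n \<Rightarrow> real^'n \<Rightarrow> real^'n \<Rightarrow> bool" where
  "backward_stable_solution \<epsilon> c\<^sub>s A g s \<longleftrightarrow>
     (\<exists>\<delta>A \<delta>g. mnorm \<delta>A \<le> c\<^sub>s * \<epsilon> * mnorm A \<and> norm \<delta>g \<le> c\<^sub>s * \<epsilon> * norm g \<and>
        (A + \<delta>A) *v s = g + \<delta>g)"

text \<open>
  \<open>SM_computed \<epsilon> c\<^sub>s A u v b y x\<close>: a run of the Sherman--Morrison algorithm in floating point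
  arithmetic that completes (so the computed \<open>\<beta>\<close> is nonzero) can yield \<open>y\<close> as
  the computed solution of \<open>A y = b\<close> and \<open>x\<close> as the output. All variables are computed
  quantities; \<open>\<sigma>\<close> is the computed \<open>v\<^sup>T z\<close> and \<open>w\<close> the computed \<open>z \<theta>\<close>.
\<close>

definition SM_computed ::
    "real \<Rightarrow> real \<Rightarrow> real^'n^'n \<Rightarrow> real^'n \<Rightarrow> real^'n \<Rightarrow> real^'n \<Rightarrow> real^'n \<Rightarrow> real^'n \<Rightarrow> bool" where
  "SM_computed \<epsilon> c\<^sub>s A u v b y x \<longleftrightarrow>
     (\<exists>z \<alpha> \<sigma> \<beta> \<theta> w.
        backward_stable_solution \<epsilon> c\<^sub>s A b y \<and>
        backward_stable_solution \<epsilon> c\<^sub>s A u z \<and>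
        computed_inner \<epsilon> v y \<alpha> \<and>
        computed_inner \<epsilon> v z \<sigma> \<and>
        rounded \<epsilon> (1 + \<sigma>) \<beta> \<and> \<beta> \<noteq> 0 \<and>
        rounded \<epsilon> (\<alpha> / \<beta>) \<theta> \<and>
        rounded_vec \<epsilon> (\<theta> *\<^sub>R z) w \<and>
        rounded_vec \<epsilon> (y - w) x)"

definition backward_error_denom :: "real^'n^'n \<Rightarrow> real^'n \<Rightarrow> real^'n \<Rightarrow> real^'n \<Rightarrow> real^'n \<Rightarrow> real" where
  "backward_error_denom A u v b x = mnorm (A + outer u v) * norm x + norm b"

definition backward_error :: "real^'n^'n \<Rightarrow> real^'n \<Rightarrow> real^'n \<Rightarrow> real^'n \<Rightarrow> real^'n \<Rightarrow> real" where
  "backward_error A u v b x =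
     norm (b - (A + outer u v) *v x) / backward_error_denom A u v b x"

end

theory Submission
  imports Defs
begin

text \<open>
  With \<open>d = y - \<theta> z - x\<close> and \<open>\<rho> = v\<^sup>T y - \<theta> v\<^sup>T z - \<theta>\<close>, formed from computed quantities, the residual
  of \<open>x\<close> is \<open>(b - A y) + \<theta> (A z - u) + A d - (\<rho> - v\<^sup>T d) u\<close>. The first two terms are the residuals of
  the stable solves, \<open>d\<close> collects the rounding errors of the final update, and \<open>\<rho>\<close> those of the two
  inner products and of \<open>\<beta>\<close> and \<open>\<theta>\<close>. To first order \<open>\<theta> z = y - x\<close> and \<open>\<theta> = v\<^sup>T x\<close>, which
  eliminates \<open>\<theta>\<close> and \<open>z\<close> from the bound. Since the exact \<open>\<beta>\<close> is nonzero, the computed one stays away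
  from zero as the unit roundoff shrinks, so \<open>y\<close> and \<open>\<theta> z\<close> are at most a constant times \<open>\<parallel>b\<parallel>\<close>. Hence
  the second-order remainder is also proportional to \<open>\<parallel>b\<parallel>\<close> and survives division by the denominator
  of the backward error, however small that is.
\<close>

section \<open>The induced norm and nonsingularity\<close>

lemma norm_mult_vec_le_mnorm: "norm (A *v x) \<le> mnorm A * norm x"
  unfolding mnorm_def by (rule onorm) (rule matrix_vector_mul_bounded_linear)

lemma mnorm_nonneg: "0 \<le> mnorm A"
  unfolding mnorm_def by (rule onorm_pos_le) (rule matrix_vector_mul_bounded_linear)

lemma outer_mult_vec: "outer u v *v x = (v \<bullet> x) *\<^sub>R u"
  by (simp add: vec_eq_iff outer_def matrix_vector_mult_def inner_vec_def sum_distrib_left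
      mult_ac)

lemma invertible_bounded_below:
  fixes A :: "real^'n^'n"
  assumes "invertible A"
  obtains \<kappa> where "0 < \<kappa>" "\<And>s. \<kappa> * norm s \<le> norm (A *v s)"
proof -
  have "inj ((*v) A)"
    using assms by (simp add: inj_matrix_vector_mult)
  then show ?thesis
    using linear_inj_bounded_below_pos[OF matrix_vector_mul_linear] that
    by (metis mult.commute)
qed

lemma mnorm_pos:
  fixes A :: "real^'n^'n"
  assumes "invertible A"
  shows "0 < mnorm A"
proof -
  obtain \<kappa> where \<kappa>: "0 < \<kappa>" "\<And>s. \<kappa> * norm s \<le> norm (A *v s)"
    using invertible_bounded_below[OF assms] by blast
  obtain s :: "real^'n" where "norm s = 1"
    using norm_axis_1 by blast
  then show ?thesis
    using \<kappa>(1) \<kappa>(2)[of s] norm_mult_vec_le_mnorm[of A s] by simp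
qed

text \<open>Since \<open>(A + outer u v) *v z\<close> is \<open>1 + v \<bullet> z\<close> times
  \<open>u\<close>, a zero factor would put \<open>z\<close> in the kernel of a nonsingular matrix.
  Then \<open>z = 0\<close>, and the factor would be 1 after all.\<close>

lemma Sherman_Morrison_denominator_nonzero:
  fixes A :: "real^'n^'n"
  assumes "invertible (A + outer u v)" and "A *v z = u"
  shows "1 + v \<bullet> z \<noteq> 0"
proof
  assume 0: "1 + v \<bullet> z = 0"
  have "(A + outer u v) *v z = (1 + v \<bullet> z) *\<^sub>R u"
    using assms(2) by (simp add: matrix_vector_mult_add_rdistrib outer_mult_vec scaleR_add_left)
  then have "(A + outer u v) *v z = (A + outer u v) *v 0"
    using 0 by simp
  then have "z = 0"
    by (rule injD[OF inj_matrix_vector_mult[OF assms(1)]])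
  then show False using 0 by simp
qed

section \<open>Rounding errors of scalar operations, vector operations and inner products\<close>

text \<open>With \<open>t = n * \<epsilon>\<close> at most 1/2, \<open>1 / (1 - t)\<close> is at
  most 2, and \<open>t / (1 - t)\<close> equals \<open>t\<close> plus \<open>t\<close> times itself.
  The linear bound serves where a factor 2 is harmless; the quadratic one keeps the coefficient
  \<open>n\<close> of the first-order term exact.\<close>

lemma gam_bounds:
  assumes "0 \<le> \<epsilon>" and "real n * \<epsilon> \<le> 1/2"
  shows "0 \<le> gam n \<epsilon>" and "gam n \<epsilon> \<le> 2 * real n * \<epsilon>"
    and "gam n \<epsilon> \<le> real n * \<epsilon> + 2 * (real n)\<^sup>2 * \<epsilon>\<^sup>2"
proof -
  define t where "t = real n * \<epsilon>"
  have t: "0 \<le> t" "t \<le> 1/2" and g: "gam n \<epsilon> = t / (1 - t)"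
    using assms by (auto simp: t_def gam_def)
  show "0 \<le> gam n \<epsilon>" using t g by simp
  have "t * (2 * t) \<le> t * 1" using t by (intro mult_left_mono) auto
  then have "t / (1 - t) \<le> 2 * t" using t by (simp add: divide_le_eq algebra_simps)
  then show "gam n \<epsilon> \<le> 2 * real n * \<epsilon>" by (simp add: g t_def)
  have "t * (t * (2 * t)) \<le> t * (t * 1)" using t by (intro mult_left_mono) auto
  then have "t / (1 - t) \<le> t + 2 * t\<^sup>2"
    using t by (simp add: divide_le_eq algebra_simps power2_eq_square)
  then show "gam n \<epsilon> \<le> real n * \<epsilon> + 2 * (real n)\<^sup>2 * \<epsilon>\<^sup>2"
    by (simp add: g t_def power_mult_distrib)
qed

lemma rounded_error:
  assumes "rounded \<epsilon> t s"
  shows "\<bar>s - t\<bar> \<le> \<epsilon> * \<bar>t\<bar>"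
proof -
  obtain \<delta> where "\<bar>\<delta>\<bar> \<le> \<epsilon>" "s = t * (1 + \<delta>)" using assms rounded_def by auto
  then show ?thesis by (simp add: algebra_simps abs_mult mult_right_mono)
qed

lemma rounded_vec_error:
  assumes "rounded_vec \<epsilon> t s" and "0 \<le> \<epsilon>"
  shows "norm (s - t) \<le> \<epsilon> * norm t"
proof -
  have "norm (s - t) \<le> norm (\<epsilon> *\<^sub>R t)"
    using assms rounded_error
    by (intro norm_le_componentwise_cart) (fastforce simp: rounded_vec_def abs_mult)
  then show ?thesis using assms by simp
qed

lemma computed_inner_error:
  fixes v w :: "real^'n"
  assumes "computed_inner \<epsilon> v w s" and "0 \<le> gam CARD('n) \<epsilon>"
  shows "\<bar>s - v \<bullet> w\<bar> \<le> gam CARD('n) \<epsilon> * norm v * norm w"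
proof -
  define g where "g = gam CARD('n) \<epsilon>"
  obtain D :: "real^'n^'n" where D: "\<And>i j. \<bar>D $ i $ j\<bar> \<le> g * mat 1 $ i $ j"
    and s: "s = v \<bullet> ((mat 1 + D) *v w)"
    using assms unfolding computed_inner_def g_def by blast
  have "(D *v w) $ i = D $ i $ i * w $ i" for i
  proof -
    have "D $ i $ j = 0" if "j \<noteq> i" for j using D[of i j] that by (simp add: mat_def)
    then have "(\<Sum>j\<in>UNIV. D $ i $ j * w $ j) = (\<Sum>j\<in>{i}. D $ i $ j * w $ j)"
      by (intro sum.mono_neutral_right) auto
    then show ?thesis by (simp add: matrix_vector_mult_def)
  qed
  moreover have "\<bar>D $ i $ i\<bar> \<le> \<bar>g\<bar>" for i using D[of i i] by (simp add: mat_def)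
  ultimately have "norm (D *v w) \<le> norm (g *\<^sub>R w)"
    by (intro norm_le_componentwise_cart) (simp add: abs_mult mult_right_mono)
  then have Dw: "norm (D *v w) \<le> g * norm w" using assms(2) by (simp add: g_def)
  have "\<bar>s - v \<bullet> w\<bar> = \<bar>v \<bullet> (D *v w)\<bar>"
    by (simp add: s matrix_vector_mult_add_rdistrib inner_add_right)
  also have "\<dots> \<le> norm v * norm (D *v w)" by (rule Cauchy_Schwarz_ineq2)
  also have "\<dots> \<le> norm v * (g * norm w)" using Dw by (rule mult_left_mono) simp
  finally show ?thesis by (simp add: g_def mult_ac)
qed

section \<open>Stable solves and bounds uniform in small unit roundoff\<close>

lemma backward_stable_residual:
  assumes "backward_stable_solution \<epsilon> c A g s"
  shows "norm (A *v s - g) \<le> c * \<epsilon> * (mnorm A * norm s + norm g)"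
proof -
  obtain E e where E: "mnorm E \<le> c * \<epsilon> * mnorm A" and e: "norm e \<le> c * \<epsilon> * norm g"
    and eq: "(A + E) *v s = g + e"
    using assms unfolding backward_stable_solution_def by blast
  have "A *v s - g = e - E *v s" using eq by (simp add: matrix_vector_mult_add_rdistrib algebra_simps)
  then have "norm (A *v s - g) \<le> norm e + norm (E *v s)" by (simp add: norm_triangle_ineq4)
  also have "norm (E *v s) \<le> c * \<epsilon> * mnorm A * norm s"
    using norm_mult_vec_le_mnorm[of E s] mult_right_mono[OF E, of "norm s"] by simp
  finally show ?thesis using e by (simp add: algebra_simps)
qed

text \<open>The theorem puts no sign condition on the stability constant. A single stable solve
  supplies one, because \<open>c\<close> times the positive number
  \<open>\<epsilon> * mnorm A\<close> dominates a norm.\<close>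

lemma backward_stable_constant_nonneg:
  fixes A :: "real^'n^'n"
  assumes "backward_stable_solution \<epsilon> c A g s" and "invertible A" and "0 < \<epsilon>"
  shows "0 \<le> c"
proof -
  obtain E :: "real^'n^'n" where "mnorm E \<le> c * \<epsilon> * mnorm A"
    using assms(1) unfolding backward_stable_solution_def by blast
  then have "0 \<le> c * (\<epsilon> * mnorm A)" using mnorm_nonneg[of E] by simp
  moreover have "0 < \<epsilon> * mnorm A" using mnorm_pos[OF assms(2)] assms(3) by simp
  ultimately show ?thesis by (metis mult_neg_pos not_le)
qed

text \<open>In \<open>\<kappa> * norm s \<le> norm (A *v s - g) + norm g\<close> the residual
  contributes a multiple of \<open>\<epsilon> * norm s\<close>, which the left side absorbs once
  \<open>\<epsilon>\<close> is small. Both constants are fixed before \<open>\<epsilon>\<close>,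
  \<open>g\<close> and \<open>s\<close>, so one pair serves both solves of every run.\<close>

lemma backward_stable_solution_bounded:
  fixes A :: "real^'n^'n"
  assumes "invertible A" and "0 \<le> c"
  obtains L \<epsilon>\<^sub>0 where "0 < L" "0 < \<epsilon>\<^sub>0"
    "\<And>\<epsilon> g s. \<lbrakk>0 < \<epsilon>; \<epsilon> \<le> \<epsilon>\<^sub>0; backward_stable_solution \<epsilon> c A g s\<rbrakk> \<Longrightarrow> norm s \<le> L * norm g"
proof -
  obtain \<kappa> where \<kappa>: "0 < \<kappa>" "\<And>s. \<kappa> * norm s \<le> norm (A *v s)"
    using invertible_bounded_below[OF assms(1)] by blast
  define a where "a = mnorm A"
  have a: "0 \<le> a" by (simp add: a_def mnorm_nonneg)
  \<comment> \<open>The two entries ensure \<open>c * \<epsilon> \<le> 1\<close> and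
    \<open>c * \<epsilon> * a \<le> \<kappa> / 2\<close>; the added ones keep the denominators
    positive when \<open>c\<close> is 0. What remains is half of \<open>\<kappa> * norm s\<close>
    against \<open>2 * norm g\<close>, hence the constant \<open>4 / \<kappa>\<close>.\<close>
  define \<epsilon>\<^sub>0 where "\<epsilon>\<^sub>0 = min (1 / (c + 1)) (\<kappa> / (2 * (c * a + 1)))"
  have ca: "0 \<le> c * a" using a assms(2) by simp
  have "0 < \<epsilon>\<^sub>0" using \<kappa> ca assms(2) by (simp add: \<epsilon>\<^sub>0_def)
  moreover have "norm s \<le> (4 / \<kappa>) * norm g"
    if \<epsilon>: "0 < \<epsilon>" "\<epsilon> \<le> \<epsilon>\<^sub>0" and s: "backward_stable_solution \<epsilon> c A g s" for \<epsilon> g s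
  proof -
    have "\<epsilon> \<le> 1 / (c + 1)" "\<epsilon> \<le> \<kappa> / (2 * (c * a + 1))" using \<epsilon> by (auto simp: \<epsilon>\<^sub>0_def)
    then have "c * \<epsilon> + \<epsilon> \<le> 1" "2 * (c * \<epsilon> * a) + 2 * \<epsilon> \<le> \<kappa>"
      using assms(2) ca by (simp_all add: le_divide_eq algebra_simps)
    then have c: "c * \<epsilon> \<le> 1" "c * \<epsilon> * a \<le> \<kappa> / 2" using \<epsilon> by auto
    have "\<kappa> * norm s \<le> norm (A *v s - g) + norm g"
      using \<kappa>(2)[of s] norm_triangle_sub[of "A *v s" g] by linarith
    also have "\<dots> \<le> c * \<epsilon> * a * norm s + c * \<epsilon> * norm g + norm g"
      using backward_stable_residual[OF s] by (simp add: a_def algebra_simps)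
    also have "\<dots> \<le> \<kappa> / 2 * norm s + 1 * norm g + norm g"
      using c by (intro add_mono mult_right_mono) auto
    finally show ?thesis using \<kappa>(1) by (simp add: field_simps)
  qed
  ultimately show ?thesis using that[of "4 / \<kappa>" \<epsilon>\<^sub>0] \<kappa>(1) by auto
qed

text \<open>The computed \<open>1 + \<sigma>\<close> differs from the exact denominator
  \<open>1 + v \<bullet> z0\<close> by the error of \<open>z\<close> and the error of the inner
  product, both of order \<open>\<epsilon>\<close>. Half of the exact modulus therefore survives.
  The rounding of the final addition is left to \<open>quotient_error\<close>.\<close>

lemma computed_beta_bounded_below:
  fixes A :: "real^'n^'n" and u v :: "real^'n"
  assumes "invertible A" and "invertible (A + outer u v)" and "0 \<le> c"
  obtains m \<epsilon>\<^sub>0 where "0 < m" "0 < \<epsilon>\<^sub>0"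
    "\<And>\<epsilon> z \<sigma>. \<lbrakk>0 < \<epsilon>; \<epsilon> \<le> \<epsilon>\<^sub>0; real CARD('n) * \<epsilon> \<le> 1/2; backward_stable_solution \<epsilon> c A u z;
       computed_inner \<epsilon> v z \<sigma>\<rbrakk> \<Longrightarrow> m \<le> \<bar>1 + \<sigma>\<bar>"
proof -
  obtain L \<epsilon>\<^sub>1 where L: "0 < L" "0 < \<epsilon>\<^sub>1"
    "\<And>\<epsilon> g s. \<lbrakk>0 < \<epsilon>; \<epsilon> \<le> \<epsilon>\<^sub>1; backward_stable_solution \<epsilon> c A g s\<rbrakk> \<Longrightarrow> norm s \<le> L * norm g"
    using backward_stable_solution_bounded[OF assms(1,3)] by blast
  obtain \<kappa> where \<kappa>: "0 < \<kappa>" "\<And>s. \<kappa> * norm s \<le> norm (A *v s)"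
    using invertible_bounded_below[OF assms(1)] by blast
  obtain z0 where z0: "A *v z0 = u"
    using assms(1) unfolding invertible_def
    by (metis matrix_vector_mul_assoc matrix_vector_mul_lid)
  define q where "q = \<bar>1 + v \<bullet> z0\<bar>"
  have q: "0 < q"
    using Sherman_Morrison_denominator_nonzero[OF assms(2) z0] by (simp add: q_def)
  \<comment> \<open>\<open>\<epsilon> * R\<close> bounds the total perturbation: the first summand
    comes from \<open>z - z0\<close>, the second from the inner product, with \<open>gam\<close> at
    most \<open>2 * n * \<epsilon>\<close>.\<close>
  define R where "R = norm v * (c * (mnorm A * (L * norm u) + norm u) / \<kappa>)
      + 2 * real CARD('n) * norm v * (L * norm u)"
  have R: "0 \<le> R" using L \<kappa> assms(3) mnorm_nonneg[of A] by (simp add: R_def)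
  define \<epsilon>\<^sub>0 where "\<epsilon>\<^sub>0 = min \<epsilon>\<^sub>1 (q / (2 * (R + 1)))"
  have "0 < \<epsilon>\<^sub>0" using L q R by (simp add: \<epsilon>\<^sub>0_def)
  moreover have "q / 2 \<le> \<bar>1 + \<sigma>\<bar>"
    if \<epsilon>: "0 < \<epsilon>" "\<epsilon> \<le> \<epsilon>\<^sub>0" "real CARD('n) * \<epsilon> \<le> 1/2"
      and z: "backward_stable_solution \<epsilon> c A u z" and \<sigma>: "computed_inner \<epsilon> v z \<sigma>" for \<epsilon> z \<sigma>
  proof -
    have nz: "norm z \<le> L * norm u" using L(3)[OF \<epsilon>(1) _ z] \<epsilon>(2) by (simp add: \<epsilon>\<^sub>0_def)
    \<comment> \<open>As \<open>A *v z0 = u\<close>, the forward error is controlled by the residual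
      of \<open>z\<close>.\<close>
    have "\<kappa> * norm (z - z0) \<le> norm (A *v z - u)"
      using \<kappa>(2)[of "z - z0"] by (simp add: matrix_vector_mult_diff_distrib z0)
    also have "\<dots> \<le> c * \<epsilon> * (mnorm A * norm z + norm u)"
      by (rule backward_stable_residual[OF z])
    also have "\<dots> \<le> c * \<epsilon> * (mnorm A * (L * norm u) + norm u)"
      using nz \<epsilon>(1) assms(3) mnorm_nonneg[of A]
      by (intro mult_left_mono add_right_mono) auto
    finally have "norm (z - z0) \<le> \<epsilon> * (c * (mnorm A * (L * norm u) + norm u) / \<kappa>)"
      using \<kappa>(1) by (simp add: field_simps)
    then have "norm v * norm (z - z0) \<le> norm v * (\<epsilon> * (c * (mnorm A * (L * norm u) + norm u) / \<kappa>))"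
      by (rule mult_left_mono) simp
    moreover have "\<bar>v \<bullet> (z - z0)\<bar> \<le> norm v * norm (z - z0)" by (rule Cauchy_Schwarz_ineq2)
    moreover have "\<bar>\<sigma> - v \<bullet> z\<bar> \<le> gam CARD('n) \<epsilon> * norm v * norm z"
      using computed_inner_error[OF \<sigma>] gam_bounds(1)[of \<epsilon> "CARD('n)"] \<epsilon> by simp
    moreover have "gam CARD('n) \<epsilon> * norm v * norm z
        \<le> (2 * real CARD('n) * \<epsilon>) * norm v * (L * norm u)"
      using gam_bounds(1,2)[of \<epsilon> "CARD('n)"] \<epsilon> nz by (intro mult_mono) auto
    ultimately have "\<bar>v \<bullet> (z - z0)\<bar> + \<bar>\<sigma> - v \<bullet> z\<bar> \<le> \<epsilon> * R"
      by (simp add: R_def algebra_simps)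
    moreover have "\<epsilon> * R \<le> q / 2"
    proof -
      have "\<epsilon> * (2 * (R + 1)) \<le> q" using \<epsilon>(2) R by (simp add: \<epsilon>\<^sub>0_def le_divide_eq)
      then show ?thesis using \<epsilon>(1) by (simp add: algebra_simps)
    qed
    moreover have "1 + \<sigma> = (1 + v \<bullet> z0) + v \<bullet> (z - z0) + (\<sigma> - v \<bullet> z)"
      by (simp add: inner_diff_right)
    ultimately show ?thesis unfolding q_def by (smt (verit) field_sum_of_halves)
  qed
  ultimately show ?thesis using that[of "q / 2" \<epsilon>\<^sub>0] q by auto
qed

section \<open>First-order errors of the final update and of \<open>\<theta>\<close>\<close>

text \<open>The error is the rounding of the product \<open>\<theta> *\<^sub>R z\<close> minus that
  of the subtraction. A crude bound through \<open>M\<close> comes first; fed back into the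
  estimates of \<open>\<theta> *\<^sub>R z\<close> and \<open>y - w\<close>, it replaces their norms
  by those of \<open>x\<close> and \<open>y\<close>, at a cost of second order only.\<close>

lemma update_error:
  assumes w: "rounded_vec \<epsilon> (\<theta> *\<^sub>R z) w" and x: "rounded_vec \<epsilon> (y - w) x"
    and \<epsilon>: "0 \<le> \<epsilon>" "\<epsilon> \<le> 1/2"
    and M: "norm y \<le> M" "norm (\<theta> *\<^sub>R z) \<le> M"
  shows "norm (y - \<theta> *\<^sub>R z - x) \<le> 4 * M * \<epsilon>"
    and "norm (y - \<theta> *\<^sub>R z - x) \<le> \<epsilon> * (2 * norm x + norm y) + 7 * M * \<epsilon>\<^sup>2"
proof -
  define T where "T = norm (\<theta> *\<^sub>R z)"
  define d where "d = norm (y - \<theta> *\<^sub>R z - x)"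
  define p where "p = norm (y - w)"
  define e where "e = norm (x - (y - w))"
  have w': "norm (w - \<theta> *\<^sub>R z) \<le> \<epsilon> * T" using rounded_vec_error[OF w \<epsilon>(1)] by (simp add: T_def)
  have e: "e \<le> \<epsilon> * p" using rounded_vec_error[OF x \<epsilon>(1)] by (simp add: e_def p_def)
  have T: "0 \<le> T" "T \<le> M" using M by (auto simp: T_def)
  have "y - \<theta> *\<^sub>R z - x = (w - \<theta> *\<^sub>R z) - (x - (y - w))" by simp
  then have d1: "d \<le> norm (w - \<theta> *\<^sub>R z) + e"
    unfolding d_def e_def by (metis norm_triangle_ineq4)
  have "p \<le> norm y + (T + norm (w - \<theta> *\<^sub>R z))"
    using norm_triangle_ineq4[of y w] norm_triangle_sub[of w "\<theta> *\<^sub>R z"]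
    unfolding p_def T_def by linarith
  moreover have "\<epsilon> * T \<le> 1 * M" using \<epsilon> T by (intro mult_mono) auto
  ultimately have p3: "p \<le> 3 * M" using w' T M by linarith
  have \<epsilon>p: "\<epsilon> * p \<le> \<epsilon> * (3 * M)" and \<epsilon>T: "\<epsilon> * T \<le> \<epsilon> * M"
    using p3 T \<epsilon> by (auto intro: mult_left_mono)
  then have d4: "d \<le> \<epsilon> * (4 * M)" using d1 w' e by (simp add: algebra_simps)
  then show "norm (y - \<theta> *\<^sub>R z - x) \<le> 4 * M * \<epsilon>" by (simp add: d_def mult_ac)
  have e3: "e \<le> \<epsilon> * (3 * M)" using \<epsilon>p e by simp
  have px: "p \<le> norm x + e"
    using norm_triangle_sub[of "y - w" x] by (simp add: p_def e_def norm_minus_commute)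
  have "\<theta> *\<^sub>R z = (y - x) - (y - \<theta> *\<^sub>R z - x)" by simp
  then have "T = norm ((y - x) - (y - \<theta> *\<^sub>R z - x))" unfolding T_def by (rule arg_cong)
  then have Tx: "T \<le> norm x + norm y + d"
    using norm_triangle_ineq4[of "y - x" "y - \<theta> *\<^sub>R z - x"] norm_triangle_ineq4[of y x]
    unfolding d_def by linarith
  have "d \<le> \<epsilon> * (T + p)" using d1 w' e by (simp add: algebra_simps)
  \<comment> \<open>The 7 is 4 from \<open>d\<close> in the bound on \<open>T\<close> plus 3 from
    \<open>e\<close> in the bound on \<open>p\<close>.\<close>
  also have "\<dots> \<le> \<epsilon> * (2 * norm x + norm y + 7 * M * \<epsilon>)"
    using Tx px e3 d4 \<epsilon> by (intro mult_left_mono) (auto simp: algebra_simps)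
  finally show "norm (y - \<theta> *\<^sub>R z - x) \<le> \<epsilon> * (2 * norm x + norm y) + 7 * M * \<epsilon>\<^sup>2"
    by (simp add: d_def algebra_simps power2_eq_square)
qed

text \<open>Both \<open>t = \<theta> * (1 + \<sigma>)\<close> and \<open>\<alpha>\<close> are
  compared with \<open>\<theta> * \<beta>\<close>: the first differs from it by the rounding of
  \<open>\<beta>\<close>, the second by the rounding of the division. Working with products avoids
  dividing by \<open>1 + \<sigma>\<close>.\<close>

lemma quotient_error:
  assumes \<beta>: "rounded \<epsilon> (1 + \<sigma>) \<beta>" "\<beta> \<noteq> 0" and \<theta>: "rounded \<epsilon> (\<alpha> / \<beta>) \<theta>" and \<epsilon>: "0 \<le> \<epsilon>" "\<epsilon> \<le> 1/2"
  shows "\<bar>\<theta> * (1 + \<sigma>)\<bar> \<le> (1 + 4 * \<epsilon>) * \<bar>\<alpha>\<bar>"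
    and "\<bar>\<theta> * (1 + \<sigma>) - \<alpha>\<bar> \<le> \<epsilon> * (2 + 4 * \<epsilon>) * \<bar>\<alpha>\<bar>"
proof -
  define t where "t = \<theta> * (1 + \<sigma>)"
  have "\<bar>\<beta> - (1 + \<sigma>)\<bar> \<le> \<epsilon> * \<bar>1 + \<sigma>\<bar>" by (rule rounded_error[OF \<beta>(1)])
  then have "\<bar>\<theta>\<bar> * \<bar>\<beta> - (1 + \<sigma>)\<bar> \<le> \<bar>\<theta>\<bar> * (\<epsilon> * \<bar>1 + \<sigma>\<bar>)" by (rule mult_left_mono) simp
  then have 1: "\<bar>\<theta> * \<beta> - t\<bar> \<le> \<epsilon> * \<bar>t\<bar>"
    by (simp add: t_def abs_mult[symmetric] right_diff_distrib mult.left_commute)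
  obtain \<delta> where \<delta>: "\<bar>\<delta>\<bar> \<le> \<epsilon>" "\<theta> = \<alpha> / \<beta> * (1 + \<delta>)" using \<theta> rounded_def by blast
  then have "\<theta> * \<beta> - \<alpha> = \<alpha> * \<delta>" using \<beta>(2) by (simp add: field_simps)
  then have 2: "\<bar>\<theta> * \<beta> - \<alpha>\<bar> \<le> \<epsilon> * \<bar>\<alpha>\<bar>" 
    using mult_left_mono[OF \<delta>(1), of "\<bar>\<alpha>\<bar>"] by (simp add: abs_mult mult.commute)
  have 3: "(1 - \<epsilon>) * \<bar>t\<bar> \<le> (1 + \<epsilon>) * \<bar>\<alpha>\<bar>" using 1 2 by (simp add: algebra_simps)
  \<comment> \<open>For \<open>\<epsilon>\<close> up to 1/2 the quotient of
    \<open>1 + \<epsilon>\<close> by \<open>1 - \<epsilon>\<close> is at most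
    \<open>1 + 4 * \<epsilon>\<close>.\<close>
  have "\<epsilon> * \<epsilon> \<le> \<epsilon> * (1/2)" using \<epsilon> by (intro mult_left_mono) auto
  then have "1 + \<epsilon> \<le> (1 - \<epsilon>) * (1 + 4 * \<epsilon>)" by (simp add: algebra_simps)
  then have "(1 + \<epsilon>) * \<bar>\<alpha>\<bar> \<le> (1 - \<epsilon>) * (1 + 4 * \<epsilon>) * \<bar>\<alpha>\<bar>" by (rule mult_right_mono) simp
  then have "(1 - \<epsilon>) * \<bar>t\<bar> \<le> (1 - \<epsilon>) * ((1 + 4 * \<epsilon>) * \<bar>\<alpha>\<bar>)" using 3 by simp
  then have 4: "\<bar>t\<bar> \<le> (1 + 4 * \<epsilon>) * \<bar>\<alpha>\<bar>" using \<epsilon> by (simp add: mult_le_cancel_left)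
  then show "\<bar>\<theta> * (1 + \<sigma>)\<bar> \<le> (1 + 4 * \<epsilon>) * \<bar>\<alpha>\<bar>" by (simp add: t_def)
  have "\<epsilon> * \<bar>t\<bar> \<le> \<epsilon> * ((1 + 4 * \<epsilon>) * \<bar>\<alpha>\<bar>)" using 4 \<epsilon>(1) by (rule mult_left_mono)
  moreover have "\<bar>t - \<alpha>\<bar> \<le> \<epsilon> * \<bar>t\<bar> + \<epsilon> * \<bar>\<alpha>\<bar>" using 1 2 by linarith
  ultimately have "\<bar>t - \<alpha>\<bar> \<le> \<epsilon> * (2 + 4 * \<epsilon>) * \<bar>\<alpha>\<bar>" by (simp add: algebra_simps)
  then show "\<bar>\<theta> * (1 + \<sigma>) - \<alpha>\<bar> \<le> \<epsilon> * (2 + 4 * \<epsilon>) * \<bar>\<alpha>\<bar>" by (simp add: t_def)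
qed

lemma computed_inner_le:
  fixes v w :: "real^'n"
  assumes "computed_inner \<epsilon> v w s" and "0 \<le> gam CARD('n) \<epsilon>"
  shows "\<bar>s\<bar> \<le> (1 + gam CARD('n) \<epsilon>) * (norm v * norm w)"
  using computed_inner_error[OF assms] Cauchy_Schwarz_ineq2[of v w] by (simp add: algebra_simps)

text \<open>The defect splits into the errors of the two inner products, that of
  \<open>\<sigma>\<close> scaled by \<open>\<theta>\<close>, and the error of the quotient. The
  crude bound is for places where the defect gets another factor \<open>\<epsilon>\<close>; the
  sharp one supplies the first-order terms. \<open>X\<close> stands for the norm of the output,
  through which \<open>T\<close> removes \<open>\<theta> *\<^sub>R z\<close> from the leading
  term.\<close>

lemma theta_equation_error:
  fixes v y z :: "real^'n"
  assumes \<alpha>: "computed_inner \<epsilon> v y \<alpha>" and \<sigma>: "computed_inner \<epsilon> v z \<sigma>"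
    and \<beta>: "rounded \<epsilon> (1 + \<sigma>) \<beta>" "\<beta> \<noteq> 0" and \<theta>: "rounded \<epsilon> (\<alpha> / \<beta>) \<theta>"
    and \<epsilon>: "0 \<le> \<epsilon>" "\<epsilon> \<le> 1/2" "real CARD('n) * \<epsilon> \<le> 1/2"
    and M: "norm y \<le> M" "norm (\<theta> *\<^sub>R z) \<le> M"
    and T: "norm (\<theta> *\<^sub>R z) \<le> X + norm y + 4 * M * \<epsilon>"
  defines "n \<equiv> real CARD('n)"
  shows "\<bar>v \<bullet> y - \<theta> * (v \<bullet> z) - \<theta>\<bar> \<le> norm v * ((4 * n + 8) * M * \<epsilon>)"
    and "\<bar>v \<bullet> y - \<theta> * (v \<bullet> z) - \<theta>\<bar> \<le>
      norm v * (\<epsilon> * (n * (X + 2 * norm y) + 2 * norm y) + 4 * M * (n\<^sup>2 + 3 * n + 1) * \<epsilon>\<^sup>2)"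
proof -
  define g where "g = gam CARD('n) \<epsilon>"
  define Y where "Y = norm y"
  define T' where "T' = norm (\<theta> *\<^sub>R z)"
  define h where "h = g * (T' + Y) + \<epsilon> * (2 + 4 * \<epsilon>) * ((1 + g) * Y)"
  have g: "0 \<le> g" "g \<le> 2 * n * \<epsilon>" "g \<le> n * \<epsilon> + 2 * n\<^sup>2 * \<epsilon>\<^sup>2"
    using gam_bounds[OF \<epsilon>(1,3)] by (auto simp: g_def n_def)
  have g1: "g \<le> 1" using g(2) \<epsilon>(3) by (simp add: n_def)
  have n: "0 \<le> n" by (simp add: n_def)
  have Y: "0 \<le> Y" "Y \<le> M" "0 \<le> T'" "T' \<le> M" using M by (auto simp: Y_def T'_def)
  have M0: "0 \<le> M" using Y by linarith
  have i1: "\<bar>\<alpha> - v \<bullet> y\<bar> \<le> g * norm v * Y"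
    using computed_inner_error[OF \<alpha>] g(1) by (simp add: g_def Y_def)
  have "\<bar>\<sigma> - v \<bullet> z\<bar> \<le> g * norm v * norm z"
    using computed_inner_error[OF \<sigma>] g(1) by (simp add: g_def)
  then have "\<bar>\<theta>\<bar> * \<bar>\<sigma> - v \<bullet> z\<bar> \<le> \<bar>\<theta>\<bar> * (g * norm v * norm z)" by (rule mult_left_mono) simp
  then have i2: "\<bar>\<theta> * \<sigma> - \<theta> * (v \<bullet> z)\<bar> \<le> g * norm v * T'"
    by (simp add: T'_def abs_mult[symmetric] right_diff_distrib mult_ac)
  have "\<bar>\<theta> * (1 + \<sigma>) - \<alpha>\<bar> \<le> \<epsilon> * (2 + 4 * \<epsilon>) * \<bar>\<alpha>\<bar>"
    using quotient_error(2)[OF \<beta> \<theta> \<epsilon>(1,2)] .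
  also have "\<dots> \<le> \<epsilon> * (2 + 4 * \<epsilon>) * ((1 + g) * (norm v * Y))"
    using computed_inner_le[OF \<alpha>] g(1) \<epsilon>(1) by (intro mult_left_mono) (auto simp: g_def Y_def)
  finally have i3: "\<bar>\<theta> * (1 + \<sigma>) - \<alpha>\<bar> \<le> \<epsilon> * (2 + 4 * \<epsilon>) * ((1 + g) * (norm v * Y))" .
  have "v \<bullet> y - \<theta> * (v \<bullet> z) - \<theta>
      = (\<theta> * \<sigma> - \<theta> * (v \<bullet> z)) - (\<theta> * (1 + \<sigma>) - \<alpha>) - (\<alpha> - v \<bullet> y)"
    by (simp add: algebra_simps)
  then have "\<bar>v \<bullet> y - \<theta> * (v \<bullet> z) - \<theta>\<bar>
      \<le> g * norm v * T' + \<epsilon> * (2 + 4 * \<epsilon>) * ((1 + g) * (norm v * Y)) + g * norm v * Y"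
    using i1 i2 i3 by linarith
  also have "\<dots> = norm v * h" by (simp add: h_def algebra_simps)
  finally have main: "\<bar>v \<bullet> y - \<theta> * (v \<bullet> z) - \<theta>\<bar> \<le> norm v * h" .
  have "g * (T' + Y) \<le> (2 * n * \<epsilon>) * (2 * M)" using g Y n \<epsilon> by (intro mult_mono) auto
  moreover have "\<epsilon> * (2 + 4 * \<epsilon>) * ((1 + g) * Y) \<le> \<epsilon> * 4 * (2 * M)"
    using g g1 Y \<epsilon> by (intro mult_mono) auto
  ultimately have "h \<le> (4 * n + 8) * M * \<epsilon>" by (simp add: h_def algebra_simps)
  then show "\<bar>v \<bullet> y - \<theta> * (v \<bullet> z) - \<theta>\<bar> \<le> norm v * ((4 * n + 8) * M * \<epsilon>)"
    using main by (meson mult_left_mono norm_ge_zero order_trans)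
  have "g * (T' + Y) \<le> (n * \<epsilon> + 2 * n\<^sup>2 * \<epsilon>\<^sup>2) * (T' + Y)"
    using g Y by (intro mult_right_mono) auto
  also have "\<dots> = n * \<epsilon> * (T' + Y) + 2 * n\<^sup>2 * \<epsilon>\<^sup>2 * (T' + Y)" by (simp add: algebra_simps)
  \<comment> \<open>\<open>T\<close> is used only in the leading term; the quadratic one can afford
    \<open>M\<close> for each norm.\<close>
  also have "\<dots> \<le> n * \<epsilon> * (X + 2 * Y + 4 * M * \<epsilon>) + 2 * n\<^sup>2 * \<epsilon>\<^sup>2 * (2 * M)"
    using T Y n \<epsilon> by (intro add_mono[OF mult_left_mono mult_left_mono]) (auto simp: T'_def Y_def)
  finally have h1: "g * (T' + Y) \<le> n * \<epsilon> * (X + 2 * Y + 4 * M * \<epsilon>) + 2 * n\<^sup>2 * \<epsilon>\<^sup>2 * (2 * M)" .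
  \<comment> \<open>In \<open>(2 + 4 * \<epsilon>) * (1 + g)\<close> only the 2 is of leading order.
    The rest, \<open>4 * \<epsilon> + g * (2 + 4 * \<epsilon>)\<close>, is itself of order
    \<open>\<epsilon>\<close> and goes to the remainder.\<close>
  have "g * (2 + 4 * \<epsilon>) \<le> (2 * n * \<epsilon>) * 4" using g n \<epsilon> by (intro mult_mono) auto
  then have "Y * (4 * \<epsilon> + g * (2 + 4 * \<epsilon>)) \<le> M * (4 * \<epsilon> + (2 * n * \<epsilon>) * 4)"
    using Y g n \<epsilon> M0 by (intro mult_mono) auto
  then have "\<epsilon> * (Y * (4 * \<epsilon> + g * (2 + 4 * \<epsilon>))) \<le> \<epsilon> * (M * (4 * \<epsilon> + (2 * n * \<epsilon>) * 4))"
    using \<epsilon>(1) by (rule mult_left_mono)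
  then have "h \<le> \<epsilon> * (n * (X + 2 * Y) + 2 * Y) + 4 * M * (n\<^sup>2 + 3 * n + 1) * \<epsilon>\<^sup>2"
    using h1 by (simp add: h_def algebra_simps power2_eq_square)
  then show "\<bar>v \<bullet> y - \<theta> * (v \<bullet> z) - \<theta>\<bar> \<le>
      norm v * (\<epsilon> * (n * (X + 2 * norm y) + 2 * norm y) + 4 * M * (n\<^sup>2 + 3 * n + 1) * \<epsilon>\<^sup>2)"
    using main unfolding Y_def by (meson mult_left_mono norm_ge_zero order_trans)
qed

section \<open>The residual of the computed solution\<close>

text \<open>Each term of the residual is estimated separately, and \<open>\<theta>\<close> and
  \<open>z\<close> are traded for \<open>x\<close> and \<open>y\<close>. The remainder is explicit
  and linear in \<open>M\<close>, so that \<open>M\<close> can later be taken proportional to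
  \<open>norm b\<close>.\<close>

lemma residual_bound:
  fixes A :: "real^'n^'n" and u v b x y z w :: "real^'n"
  assumes y: "backward_stable_solution \<epsilon> c A b y" and z: "backward_stable_solution \<epsilon> c A u z"
    and \<alpha>: "computed_inner \<epsilon> v y \<alpha>" and \<sigma>: "computed_inner \<epsilon> v z \<sigma>"
    and \<beta>: "rounded \<epsilon> (1 + \<sigma>) \<beta>" "\<beta> \<noteq> 0" and \<theta>: "rounded \<epsilon> (\<alpha> / \<beta>) \<theta>"
    and w: "rounded_vec \<epsilon> (\<theta> *\<^sub>R z) w" and x: "rounded_vec \<epsilon> (y - w) x"
    and \<epsilon>: "0 \<le> \<epsilon>" "\<epsilon> \<le> 1/2" "real CARD('n) * \<epsilon> \<le> 1/2" and c: "0 \<le> c"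
    and M: "norm y \<le> M" "norm (\<theta> *\<^sub>R z) \<le> M"
  defines "n \<equiv> real CARD('n)" and "a \<equiv> mnorm A" and "p \<equiv> norm u * norm v"
  shows "norm (b - (A + outer u v) *v x) \<le>
    \<epsilon> * (n + 2 + c) * ((a + p) * norm x + norm b) +
    \<epsilon> * (2 * n + 3 + 2 * c) * ((a + p) * norm y) +
    (4 * c * a + c * p * (4 * n + 12) + 7 * (a + p) + 4 * p * (n\<^sup>2 + 3 * n + 1)) * M * \<epsilon>\<^sup>2"
proof -
  define d where "d = y - \<theta> *\<^sub>R z - x"
  define \<rho> where "\<rho> = v \<bullet> y - \<theta> * (v \<bullet> z) - \<theta>"
  define X where "X = norm x"
  define Y where "Y = norm y"
  define T where "T = norm (\<theta> *\<^sub>R z)"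
  have n: "0 \<le> n" and a: "0 \<le> a" and p: "0 \<le> p"
    by (auto simp: n_def a_def p_def mnorm_nonneg)
  have XY: "0 \<le> X" "0 \<le> Y" by (auto simp: X_def Y_def)
  have d: "norm d \<le> 4 * M * \<epsilon>" "norm d \<le> \<epsilon> * (2 * X + Y) + 7 * M * \<epsilon>\<^sup>2"
    using update_error[OF w x \<epsilon>(1,2) M] by (auto simp: d_def X_def Y_def)
  have "\<theta> *\<^sub>R z = (y - x) - d" by (simp add: d_def)
  then have "T = norm ((y - x) - d)" unfolding T_def by (rule arg_cong)
  then have "T \<le> X + Y + norm d"
    using norm_triangle_ineq4[of "y - x" d] norm_triangle_ineq4[of y x]
    unfolding X_def Y_def by linarith
  then have T: "T \<le> X + Y + 4 * M * \<epsilon>" using d by linarith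
  define \<rho>\<^sub>0 where "\<rho>\<^sub>0 = \<epsilon> * (n * (X + 2 * Y) + 2 * Y) + 4 * M * (n\<^sup>2 + 3 * n + 1) * \<epsilon>\<^sup>2"
  have \<rho>: "\<bar>\<rho>\<bar> \<le> norm v * ((4 * n + 8) * M * \<epsilon>)" "\<bar>\<rho>\<bar> \<le> norm v * \<rho>\<^sub>0"
    using theta_equation_error[OF \<alpha> \<sigma> \<beta> \<theta> \<epsilon> M, of X] T
    by (auto simp: \<rho>_def T_def Y_def n_def \<rho>\<^sub>0_def)
  have vx: "\<theta> = v \<bullet> x - \<rho> + v \<bullet> d"
    by (simp add: \<rho>_def d_def inner_diff_right)
  have vd: "\<bar>v \<bullet> d\<bar> \<le> norm v * norm d" by (rule Cauchy_Schwarz_ineq2)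
  have "norm v * norm d \<le> norm v * (4 * M * \<epsilon>)" using d(1) by (rule mult_left_mono) simp
  then have "\<bar>\<theta>\<bar> \<le> norm v * X + norm v * ((4 * n + 8) * M * \<epsilon>) + norm v * (4 * M * \<epsilon>)"
    using vx vd \<rho>(1) Cauchy_Schwarz_ineq2[of v x] unfolding X_def by linarith
  \<comment> \<open>The 12 is 8 from the crude bound on \<open>\<rho>\<close> plus 4 from the one on
    \<open>d\<close>.\<close>
  then have "\<bar>\<theta>\<bar> \<le> norm v * (X + (4 * n + 12) * M * \<epsilon>)" by (simp add: algebra_simps)
  then have "norm u * \<bar>\<theta>\<bar> \<le> norm u * (norm v * (X + (4 * n + 12) * M * \<epsilon>))"
    by (rule mult_left_mono) simp
  then have \<theta>u: "norm u * \<bar>\<theta>\<bar> \<le> p * (X + (4 * n + 12) * M * \<epsilon>)" by (simp add: p_def mult.assoc)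
  have r1: "norm (A *v y - b) \<le> c * \<epsilon> * (a * Y + norm b)"
    using backward_stable_residual[OF y] by (simp add: a_def Y_def)
  have "\<bar>\<theta>\<bar> * norm (A *v z - u) \<le> \<bar>\<theta>\<bar> * (c * \<epsilon> * (a * norm z + norm u))"
    using backward_stable_residual[OF z] unfolding a_def by (rule mult_left_mono) simp
  also have "\<dots> = c * \<epsilon> * (a * T + norm u * \<bar>\<theta>\<bar>)" by (simp add: T_def algebra_simps)
  also have "\<dots> \<le> c * \<epsilon> * (a * (X + Y + 4 * M * \<epsilon>) + p * (X + (4 * n + 12) * M * \<epsilon>))"
    using c \<epsilon> a T \<theta>u by (intro mult_left_mono add_mono) auto
  finally have r2: "norm (\<theta> *\<^sub>R (A *v z - u))
      \<le> c * \<epsilon> * (a * (X + Y + 4 * M * \<epsilon>) + p * (X + (4 * n + 12) * M * \<epsilon>))" by simp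
  have "norm (A *v d) \<le> a * norm d" unfolding a_def by (rule norm_mult_vec_le_mnorm)
  also have "\<dots> \<le> a * (\<epsilon> * (2 * X + Y) + 7 * M * \<epsilon>\<^sup>2)" using d(2) a by (rule mult_left_mono)
  finally have r3: "norm (A *v d) \<le> a * (\<epsilon> * (2 * X + Y) + 7 * M * \<epsilon>\<^sup>2)" .
  have "\<bar>\<rho> - v \<bullet> d\<bar> \<le> norm v * \<rho>\<^sub>0 + norm v * (\<epsilon> * (2 * X + Y) + 7 * M * \<epsilon>\<^sup>2)"
    using \<rho>(2) vd mult_left_mono[OF d(2) norm_ge_zero[of v]] by linarith
  then have "norm u * \<bar>\<rho> - v \<bullet> d\<bar> \<le> norm u * (norm v * \<rho>\<^sub>0 + norm v * (\<epsilon> * (2 * X + Y) + 7 * M * \<epsilon>\<^sup>2))"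
    by (rule mult_left_mono) simp
  then have r4: "norm ((\<rho> - v \<bullet> d) *\<^sub>R u) \<le> p * (\<rho>\<^sub>0 + (\<epsilon> * (2 * X + Y) + 7 * M * \<epsilon>\<^sup>2))"
    unfolding norm_scaleR p_def by (simp add: algebra_simps)
  have Ax: "A *v x = A *v y - \<theta> *\<^sub>R (A *v z) - A *v d"
    by (simp add: d_def matrix_vector_mult_diff_distrib matrix_vector_mult_scaleR)
  have "b - (A + outer u v) *v x
      = \<theta> *\<^sub>R (A *v z - u) - (A *v y - b) + A *v d + (\<theta> - v \<bullet> x) *\<^sub>R u"
    by (simp add: matrix_vector_mult_add_rdistrib outer_mult_vec Ax algebra_simps)
  also have "\<theta> - v \<bullet> x = - (\<rho> - v \<bullet> d)" using vx by simp
  finally have "b - (A + outer u v) *v x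
      = \<theta> *\<^sub>R (A *v z - u) - (A *v y - b) + A *v d - (\<rho> - v \<bullet> d) *\<^sub>R u"
    by (simp only: scaleR_minus_left add_uminus_conv_diff)
  then have "norm (b - (A + outer u v) *v x) \<le> norm (\<theta> *\<^sub>R (A *v z - u)) + norm (A *v y - b)
      + norm (A *v d) + norm ((\<rho> - v \<bullet> d) *\<^sub>R u)"
    by (smt (verit) norm_triangle_ineq norm_triangle_ineq4)
  also have "\<dots> \<le> c * \<epsilon> * (a * (X + Y + 4 * M * \<epsilon>) + p * (X + (4 * n + 12) * M * \<epsilon>))
      + c * \<epsilon> * (a * Y + norm b) + a * (\<epsilon> * (2 * X + Y) + 7 * M * \<epsilon>\<^sup>2)
      + p * (\<rho>\<^sub>0 + (\<epsilon> * (2 * X + Y) + 7 * M * \<epsilon>\<^sup>2))"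
    by (intro add_mono r1 r2 r3 r4)
  \<comment> \<open>The coefficients of \<open>\<epsilon>\<close> collected so far are
    \<open>c + 2\<close> for \<open>a * X\<close>, \<open>n + 2 + c\<close> for
    \<open>p * X\<close>, \<open>c\<close> for \<open>norm b\<close>, \<open>2 * c + 1\<close> for
    \<open>a * Y\<close> and \<open>2 * n + 3\<close> for \<open>p * Y\<close>. Raising them to the
    two common coefficients of the claim leaves the nonnegative slack subtracted here.\<close>
  also have "\<dots> = \<epsilon> * (n + 2 + c) * ((a + p) * X + norm b)
      + \<epsilon> * (2 * n + 3 + 2 * c) * ((a + p) * Y)
      + (4 * c * a + c * p * (4 * n + 12) + 7 * (a + p) + 4 * p * (n\<^sup>2 + 3 * n + 1)) * M * \<epsilon>\<^sup>2
      - \<epsilon> * (n * (a * X) + (n + 2) * norm b + (2 * n + 2) * (a * Y) + 2 * c * (p * Y))"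
    unfolding \<rho>\<^sub>0_def by (simp add: algebra_simps power2_eq_square)
  also have "\<dots> \<le> \<epsilon> * (n + 2 + c) * ((a + p) * X + norm b)
      + \<epsilon> * (2 * n + 3 + 2 * c) * ((a + p) * Y)
      + (4 * c * a + c * p * (4 * n + 12) + 7 * (a + p) + 4 * p * (n\<^sup>2 + 3 * n + 1)) * M * \<epsilon>\<^sup>2"
    using \<epsilon>(1) n a p c XY by simp
  finally show ?thesis by (simp add: X_def Y_def)
qed

section \<open>From the residual to the relative backward error\<close>

theorem theorem2p2:
  fixes A :: "real^'n^'n" and u v b :: "real^'n" and c\<^sub>s :: real
  assumes "invertible A" and "invertible (A + outer u v)"
  shows "\<exists>C \<epsilon>\<^sub>0. \<epsilon>\<^sub>0 > 0 \<and>
    (\<forall>\<epsilon> y x. 0 < \<epsilon> \<and> \<epsilon> \<le> \<epsilon>\<^sub>0 \<and> real CARD('n) * \<epsilon> < 1 \<and>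
       SM_computed \<epsilon> c\<^sub>s A u v b y x \<and> backward_error_denom A u v b x \<noteq> 0 \<longrightarrow>
       backward_error A u v b x \<le>
         \<epsilon> * (real CARD('n) + 2 + c\<^sub>s) *
           (((mnorm A + norm u * norm v) * norm x + norm b) / backward_error_denom A u v b x) +
         \<epsilon> * (2 * real CARD('n) + 3 + 2 * c\<^sub>s) *
           (((mnorm A + norm u * norm v) * norm y) / backward_error_denom A u v b x) +
         C * \<epsilon>\<^sup>2)"
proof (cases "0 \<le> c\<^sub>s")
  \<comment> \<open>With a negative stability constant no run exists, so the claim is
    vacuous.\<close>
  case False
  then have "\<not> SM_computed \<epsilon> c\<^sub>s A u v b y x" if "0 < \<epsilon>" for \<epsilon> y x
    using backward_stable_constant_nonneg[OF _ assms(1) that] unfolding SM_computed_def by blast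
  then show ?thesis by (intro exI[of _ 0] exI[of _ 1]) auto
next
  case c: True
  obtain L \<epsilon>\<^sub>1 where L: "0 < L" "0 < \<epsilon>\<^sub>1"
    "\<And>\<epsilon> g s. \<lbrakk>0 < \<epsilon>; \<epsilon> \<le> \<epsilon>\<^sub>1; backward_stable_solution \<epsilon> c\<^sub>s A g s\<rbrakk> \<Longrightarrow> norm s \<le> L * norm g"
    using backward_stable_solution_bounded[OF assms(1) c] by blast
  obtain m \<epsilon>\<^sub>2 where m: "0 < m" "0 < \<epsilon>\<^sub>2"
    "\<And>\<epsilon> z \<sigma>. \<lbrakk>0 < \<epsilon>; \<epsilon> \<le> \<epsilon>\<^sub>2; real CARD('n) * \<epsilon> \<le> 1/2; backward_stable_solution \<epsilon> c\<^sub>s A u z;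
       computed_inner \<epsilon> v z \<sigma>\<rbrakk> \<Longrightarrow> m \<le> \<bar>1 + \<sigma>\<bar>"
    using computed_beta_bounded_below[OF assms c] by blast
  define n where "n = real CARD('n)"
  define a where "a = mnorm A"
  define p where "p = norm u * norm v"
  define K where "K = 4 * c\<^sub>s * a + c\<^sub>s * p * (4 * n + 12) + 7 * (a + p) + 4 * p * (n\<^sup>2 + 3 * n + 1)"
  \<comment> \<open>Per unit of \<open>norm b\<close>, the first summand bounds \<open>y\<close> and
    the second \<open>\<theta> *\<^sub>R z\<close>. The 6 is 2 from \<open>1 + gam\<close> in the
    bound on \<open>\<alpha>\<close> times 3 from \<open>1 + 4 * \<epsilon>\<close> in
    \<open>quotient_error\<close>; \<open>L * norm u\<close> bounds \<open>z\<close>.\<close>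
  define M where "M = L + 6 * norm v * L * (L * norm u) / m"
  have n: "1 \<le> n" by (simp add: n_def Suc_le_eq)
  have a: "0 \<le> a" and p: "0 \<le> p" by (auto simp: a_def p_def mnorm_nonneg)
  have K: "0 \<le> K" using c n a p by (simp add: K_def)
  have M: "0 \<le> M" using L m by (simp add: M_def)
  \<comment> \<open>The last entry gives \<open>n * \<epsilon> \<le> 1/2\<close>, hence
    \<open>gam\<close> at most 1 and, as \<open>n\<close> is at least 1, also
    \<open>\<epsilon> \<le> 1/2\<close>.\<close>
  define \<epsilon>\<^sub>0 where "\<epsilon>\<^sub>0 = min (min \<epsilon>\<^sub>1 \<epsilon>\<^sub>2) (1 / (2 * n))"
  have "0 < \<epsilon>\<^sub>0" using L m n by (simp add: \<epsilon>\<^sub>0_def)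
  moreover have "backward_error A u v b x \<le>
      \<epsilon> * (n + 2 + c\<^sub>s) * (((a + p) * norm x + norm b) / backward_error_denom A u v b x) +
      \<epsilon> * (2 * n + 3 + 2 * c\<^sub>s) * (((a + p) * norm y) / backward_error_denom A u v b x) +
      (K * M) * \<epsilon>\<^sup>2"
    if \<epsilon>: "0 < \<epsilon>" "\<epsilon> \<le> \<epsilon>\<^sub>0" and run: "SM_computed \<epsilon> c\<^sub>s A u v b y x"
      and ne: "backward_error_denom A u v b x \<noteq> 0" for \<epsilon> y x
  proof -
    obtain z \<alpha> \<sigma> \<beta> \<theta> w where
      y: "backward_stable_solution \<epsilon> c\<^sub>s A b y" and z: "backward_stable_solution \<epsilon> c\<^sub>s A u z"
      and \<alpha>: "computed_inner \<epsilon> v y \<alpha>" and \<sigma>: "computed_inner \<epsilon> v z \<sigma>"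
      and \<beta>: "rounded \<epsilon> (1 + \<sigma>) \<beta>" "\<beta> \<noteq> 0" and \<theta>: "rounded \<epsilon> (\<alpha> / \<beta>) \<theta>"
      and w: "rounded_vec \<epsilon> (\<theta> *\<^sub>R z) w" and x: "rounded_vec \<epsilon> (y - w) x"
      using run unfolding SM_computed_def by blast
    have "\<epsilon> \<le> 1 / (2 * n)" using \<epsilon>(2) by (simp add: \<epsilon>\<^sub>0_def)
    then have n\<epsilon>: "n * \<epsilon> \<le> 1/2" using n by (simp add: field_simps)
    moreover have "1 * \<epsilon> \<le> n * \<epsilon>" using n \<epsilon>(1) by (intro mult_right_mono) auto
    ultimately have \<epsilon>2: "\<epsilon> \<le> 1/2" by linarith
    have ny: "norm y \<le> L * norm b" using L(3)[OF \<epsilon>(1) _ y] \<epsilon>(2) by (simp add: \<epsilon>\<^sub>0_def)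
    have nz: "norm z \<le> L * norm u" using L(3)[OF \<epsilon>(1) _ z] \<epsilon>(2) by (simp add: \<epsilon>\<^sub>0_def)
    have g: "0 \<le> gam CARD('n) \<epsilon>" "gam CARD('n) \<epsilon> \<le> 1"
      using gam_bounds(1,2)[of \<epsilon> "CARD('n)"] \<epsilon>(1) n\<epsilon> by (auto simp: n_def)
    have "\<bar>\<alpha>\<bar> \<le> (1 + gam CARD('n) \<epsilon>) * (norm v * norm y)"
      by (rule computed_inner_le[OF \<alpha> g(1)])
    also have "\<dots> \<le> 2 * (norm v * (L * norm b))"
      using g ny by (intro mult_mono) auto
    finally have \<alpha>b: "\<bar>\<alpha>\<bar> \<le> 2 * (norm v * (L * norm b))" .
    have "m \<le> \<bar>1 + \<sigma>\<bar>" using m(3)[OF \<epsilon>(1) _ _ z \<sigma>] \<epsilon>(2) n\<epsilon> by (simp add: \<epsilon>\<^sub>0_def n_def)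
    then have "\<bar>\<theta>\<bar> * m \<le> \<bar>\<theta>\<bar> * \<bar>1 + \<sigma>\<bar>" by (rule mult_left_mono) simp
    also have "\<dots> \<le> (1 + 4 * \<epsilon>) * \<bar>\<alpha>\<bar>"
      using quotient_error(1)[OF \<beta> \<theta>] \<epsilon>(1) \<epsilon>2 by (simp add: abs_mult)
    also have "\<dots> \<le> 3 * (2 * (norm v * (L * norm b)))"
      using \<alpha>b \<epsilon>(1) \<epsilon>2 by (intro mult_mono) auto
    finally have "\<bar>\<theta>\<bar> \<le> 6 * norm v * L * norm b / m" using m(1) by (simp add: field_simps)
    then have "\<bar>\<theta>\<bar> * norm z \<le> (6 * norm v * L * norm b / m) * (L * norm u)"
      using nz L(1) m(1) by (intro mult_mono) auto
    then have Tb: "norm (\<theta> *\<^sub>R z) \<le> (6 * norm v * L * (L * norm u) / m) * norm b"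
      by (simp add: mult_ac)
    have "0 \<le> (6 * norm v * L * (L * norm u) / m) * norm b" using L(1) m(1) by simp
    moreover have "0 \<le> L * norm b" using L(1) by simp
    ultimately have yM: "norm y \<le> M * norm b" and TM: "norm (\<theta> *\<^sub>R z) \<le> M * norm b"
      using ny Tb by (auto simp: M_def distrib_right)
    define D where "D = backward_error_denom A u v b x"
    have bD: "norm b \<le> D" by (simp add: D_def backward_error_denom_def mnorm_nonneg)
    then have D: "0 < D" using ne norm_ge_zero[of b] unfolding D_def by linarith
    have "norm (b - (A + outer u v) *v x) \<le>
        \<epsilon> * (n + 2 + c\<^sub>s) * ((a + p) * norm x + norm b) +
        \<epsilon> * (2 * n + 3 + 2 * c\<^sub>s) * ((a + p) * norm y) + K * (M * norm b) * \<epsilon>\<^sup>2"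
      using residual_bound[OF y z \<alpha> \<sigma> \<beta> \<theta> w x _ \<epsilon>2 _ c yM TM] \<epsilon>(1) n\<epsilon>
      by (simp add: n_def a_def p_def K_def)
    \<comment> \<open>\<open>norm b\<close> is a summand of \<open>D\<close>, so \<open>D\<close>
      cancels and the constant \<open>K * M\<close> is independent of the run.\<close>
    also have "K * (M * norm b) * \<epsilon>\<^sup>2 \<le> K * (M * D) * \<epsilon>\<^sup>2"
      using K M bD by (intro mult_right_mono mult_left_mono) auto
    finally have "norm (b - (A + outer u v) *v x) / D \<le>
        (\<epsilon> * (n + 2 + c\<^sub>s) * ((a + p) * norm x + norm b) +
        \<epsilon> * (2 * n + 3 + 2 * c\<^sub>s) * ((a + p) * norm y) + K * (M * D) * \<epsilon>\<^sup>2) / D"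
      using D by (simp add: divide_right_mono)
    then show ?thesis
      using D by (simp add: backward_error_def D_def[symmetric] add_divide_distrib algebra_simps)
  qed
  ultimately show ?thesis unfolding n_def a_def p_def by blast
qed

end
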